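(* Let $i\in\{0,1\}$. For every primitive vector $P\in\mathbb Z^2$, the map $f\mapsto E_{f,P}$ is a bijection $\mathcal R_P^{(i)}\to\mathcal E_P^{(i)}$.
   Context: $\mathrm{GL}_2(\mathbb R)$ acts on real binary cubic forms by $(g\cdot f)(X,Y)=\det(g)^{-1}f((X,Y)g)$, with $(X,Y)$ a row vector. For $f=aX^3+bX^2Y+cXY^2+dY^3$, $\mathrm{Disc}(f)=b^2c^2-4ac^3-4b^3d-27a^2d^2+18abcd$. Index $i=0$ refers to positive discriminant, $i=1$ to negative discriminant. Reduced forms: an irreducible integral binary cubic form $f=ax^3+bx^2y+cxy^2+dy^3$ corresponds (Delone–Faddeev) to the based cubic ring $R(f)=\langle1,\omega,\theta\rangle_{\mathbb Z}$ with $\omega\theta=-ad$, $\omega^2=-ac+b\omega-a\theta$, $\theta^2=-bd+d\omega-c\theta$. If $\mathrm{Disc}(f)<0$, then $R(f)\otimes\mathbb R\simeq\mathbb R\oplus\mathbb C$; let $z_\omega,z_\theta$ be the images of $\omega,\theta$ in $(\mathbb R\oplus\mathbb C)/\mathbb R(1,1)\simeq\mathbb C$, with the complex embedding chosen so that $\Im(z_\theta/z_\omega)>0$, and $\tau_f=z_\theta/z_\omega$. If $\mathrm{Disc}(f)>0$, let $x^0=x-\mathrm{Tr}(x)/3$, $A_0=\mathrm{Tr}((\omega^0)^2)$, $B_0=\mathrm{Tr}(\omega^0\theta^0)$, $C_0=\mathrm{Tr}((\theta^0)^2)$, and $\tau_f=(B_0+\sqrt{-1}\sqrt{A_0C_0-B_0^2})/A_0$.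 The form $f$ is reduced if $\tau_f\in\mathfrak F=\{z\in\mathbb C:\Im z>0,\ |z|\ge1,\ |\Re z|\le\frac12\}$. Choose once and for all one reduced representative in each $\mathrm{SL}_2(\mathbb Z)$-orbit of irreducible (over $\mathbb Q$) integral binary cubic forms of discriminant sign $i$; $\mathcal R^{(i)}$ is the set of chosen representatives. Put $\mathcal R_P^{(i)}=\{f\in\mathcal R^{(i)}:f(P)=1\}$. Normalized models: a normalized integral Weierstrass model is an equation $E:y^2=x^3+ux^2+Ax+B$ with $u\in\{0,1,2\}$, $A,B\in\mathbb Z$ (two models are equal when the equations are equal); its binary cubic form is $F_E(X,Y)=X^3+uX^2Y+AXY^2+BY^3$. $\mathcal K_{\mathrm{irr}}^{(i)}$ is the set of forms $X^3+uX^2Y+AXY^2+BY^3$ with $u\in\{0,1,2\}$, $A,B\in\mathbb Z$, irreducible over $\mathbb Q$, with discriminant of sign $i$. Define $\mathcal E_P^{(i)}$ as the set of normalized models $E$ with $F_E\in\mathcal K_{\mathrm{irr}}^{(i)}$ for which there exists $U\in\mathrm{SL}_2(\mathbb Z)$ with $U\cdot F_E\in\mathcal R^{(i)}$ and $(1,0)U^{-1}=P$. The model $E_{f,P}$: for $f$ irreducible integral and $P\in\mathbb Z^2$ with $f(P)=1$, choose $M_P\in\mathrm{SL}_2(\mathbb Z)$ with first row $P$; then $M_P\cdot f=X^3+bX^2Y+cXY^2+dY^3$ is monic. Let $u\in\{0,1,2\}$, $u\equiv b\pmod3$, $k=(u-b)/3$, $T_k=\begin{pmatrix}1&0\\k&1\end{pmatrix}$,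 $F_{f,P}=T_kM_P\cdot f=X^3+uX^2Y+AXY^2+BY^3$; then $E_{f,P}:y^2=x^3+ux^2+Ax+B$. This does not depend on the choice of $M_P$. *)

theory Defs
  imports "HOL-Analysis.Analysis" "HOL-Computational_Algebra.Polynomial"
begin

section \<open>Binary cubic forms\<close>

text \<open>\<open>BCF a b c d\<close> is \<open>a X^3 + b X^2 Y + c X Y^2 + d Y^3\<close>.\<close>

datatype 'a bcf = BCF (cf_a: 'a) (cf_b: 'a) (cf_c: 'a) (cf_d: 'a)

definition bcf_eval :: "'a::comm_ring_1 bcf \<Rightarrow> 'a ^ 2 \<Rightarrow> 'a" where
  "bcf_eval f v = cf_a f * (v $ 1) ^ 3 + cf_b f * (v $ 1)\<^sup>2 * v $ 2
     + cf_c f * v $ 1 * (v $ 2)\<^sup>2 + cf_d f * (v $ 2) ^ 3"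

definition bcf_disc :: "'a::comm_ring_1 bcf \<Rightarrow> 'a" where
  "bcf_disc f = (case f of BCF a b c d \<Rightarrow>
     b\<^sup>2 * c\<^sup>2 - 4 * a * c ^ 3 - 4 * b ^ 3 * d - 27 * a\<^sup>2 * d\<^sup>2 + 18 * a * b * c * d)"

text \<open>
  The polynomial attached to a form lives in \<open>K[Y][X]\<close>: the outer variable is \<open>X\<close>,
  the inner one \<open>Y\<close>.
\<close>

definition bcf_poly :: "'a::comm_ring_1 bcf \<Rightarrow> 'a poly poly" where
  "bcf_poly f = [: monom (cf_d f) 3, monom (cf_c f) 2, monom (cf_b f) 1, monom (cf_a f) 0 :]"

definition irreducible_over_Q :: "int bcf \<Rightarrow> bool" where
  "irreducible_over_Q f \<longleftrightarrow> irreducible (bcf_poly (map_bcf rat_of_int f))"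

text \<open>
  The action \<open>(g \<cdot> f)(X, Y) = det(g)\<^sup>-\<^sup>1 f((X, Y) g)\<close>, with the coefficients of
  \<open>f(p X + r Y, q X + s Y)\<close> written out for \<open>g\<close> with rows \<open>(p, q)\<close> and \<open>(r, s)\<close>.
  Over a field, \<open>div\<close> is division; over \<open>int\<close> it is exact when \<open>det g\<close> is a unit, so the
  definition covers both \<open>GL\<^sub>2(\<real>)\<close> acting on real forms and \<open>SL\<^sub>2(\<int>)\<close> acting on integral ones.
\<close>

definition bcf_act :: "'a::idom_divide ^ 2 ^ 2 \<Rightarrow> 'a bcf \<Rightarrow> 'a bcf" where
  "bcf_act g f =
    (let a = cf_a f; b = cf_b f; c = cf_c f; d = cf_d f;
         p = g $ 1 $ 1; q = g $ 1 $ 2; r = g $ 2 $ 1; s = g $ 2 $ 2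
     in BCF
      ((a * p ^ 3 + b * p\<^sup>2 * q + c * p * q\<^sup>2 + d * q ^ 3) div det g)
      ((3 * a * p\<^sup>2 * r + b * (p\<^sup>2 * s + 2 * p * q * r) + c * (2 * p * q * s + q\<^sup>2 * r)
         + 3 * d * q\<^sup>2 * s) div det g)
      ((3 * a * p * r\<^sup>2 + b * (2 * p * r * s + q * r\<^sup>2) + c * (p * s\<^sup>2 + 2 * q * r * s)
         + 3 * d * q * s\<^sup>2) div det g)
      ((a * r ^ 3 + b * r\<^sup>2 * s + c * r * s\<^sup>2 + d * s ^ 3) div det g))"

lemma vec_matrix_mult_2:
  fixes v :: "'a::comm_ring_1 ^ 2" and g :: "'a ^ 2 ^ 2"
  shows "(v v* g) $ j = v $ 1 * g $ 1 $ j + v $ 2 * g $ 2 $ j"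
  by (simp add: vector_matrix_mult_def sum_2 mult.commute)

lemma bcf_eval_act_field:
  fixes f :: "'a::field bcf"
  shows "bcf_eval (bcf_act g f) v = inverse (det g) * bcf_eval f (v v* g)"
proof -
  have div_eq: "x div y = inverse y * x" for x y :: 'a
    by (simp add: field_simps)
  show ?thesis
    unfolding bcf_eval_def bcf_act_def Let_def bcf.sel vec_matrix_mult_2 div_eq
    by algebra
qed

lemma bcf_eval_act_int:
  fixes f :: "int bcf"
  assumes "det g = 1"
  shows "bcf_eval (bcf_act g f) v = bcf_eval f (v v* g)"
  unfolding bcf_eval_def bcf_act_def Let_def bcf.sel vec_matrix_mult_2 assms div_by_1
  by algebra

lemma bcf_act_mult_int:
  fixes f :: "int bcf"
  assumes "det g = 1" "det h = 1"
  shows "bcf_act (g ** h) f = bcf_act g (bcf_act h f)"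
proof -
  have e: "(g ** h) $ i $ j = g $ i $ 1 * h $ 1 $ j + g $ i $ 2 * h $ 2 $ j" for i j
    by (simp add: matrix_matrix_mult_def sum_2)
  show ?thesis
    unfolding bcf_act_def Let_def bcf.sel det_mul assms mult_1 div_by_1 bcf.inject e
    by (intro conjI; algebra)
qed

definition SL2Z :: "(int ^ 2 ^ 2) set" where
  "SL2Z = {g. det g = 1}"

definition SL2Z_orbit :: "int bcf \<Rightarrow> int bcf set" where
  "SL2Z_orbit f = {bcf_act g f | g. g \<in> SL2Z}"

text \<open>Index \<open>0\<close> stands for positive and index \<open>1\<close> for negative discriminant.\<close>

definition disc_sign :: "nat \<Rightarrow> int bcf \<Rightarrow> bool" where
  "disc_sign i f \<longleftrightarrow> (i = 0 \<and> bcf_disc f > 0) \<or> (i = 1 \<and> bcf_disc f < 0)"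

definition irr_forms :: "nat \<Rightarrow> int bcf set" where
  "irr_forms i = {f. irreducible_over_Q f \<and> disc_sign i f}"


section \<open>The based cubic ring of a form\<close>

text \<open>
  The vector with entries \<open>x, y, z\<close> stands for \<open>x + y \<omega> + z \<theta>\<close>.  Coefficients in \<open>int\<close> give the
  cubic ring \<open>R(f)\<close>; extending those of \<open>f\<close> to \<open>real\<close> gives \<open>R(f) \<otimes> \<real>\<close>.
\<close>

definition cr_one :: "'a::comm_ring_1 ^ 3" where
  "cr_one = vector [1, 0, 0]"

definition cr_omega :: "'a::comm_ring_1 ^ 3" where
  "cr_omega = vector [0, 1, 0]"

definition cr_theta :: "'a::comm_ring_1 ^ 3" where
  "cr_theta = vector [0, 0, 1]"

definition cr_mult :: "'a::comm_ring_1 bcf \<Rightarrow> 'a ^ 3 \<Rightarrow> 'a ^ 3 \<Rightarrow> 'a ^ 3" where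
  "cr_mult f x y = (case f of BCF a b c d \<Rightarrow> vector
     [x$1 * y$1 - a * c * (x$2 * y$2) - a * d * (x$2 * y$3 + x$3 * y$2) - b * d * (x$3 * y$3),
      x$1 * y$2 + x$2 * y$1 + b * (x$2 * y$2) + d * (x$3 * y$3),
      x$1 * y$3 + x$3 * y$1 - a * (x$2 * y$2) - c * (x$3 * y$3)])"

lemma cr_mult_table:
  fixes a b c d :: "'a::comm_ring_1"
  defines "f \<equiv> BCF a b c d"
  shows "cr_mult f cr_one x = x"
    and "cr_mult f cr_omega cr_theta = - (a * d) *s cr_one"
    and "cr_mult f cr_omega cr_omega = - (a * c) *s cr_one + b *s cr_omega - a *s cr_theta"
    and "cr_mult f cr_theta cr_theta = - (b * d) *s cr_one + d *s cr_omega - c *s cr_theta"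
  by (simp_all add: f_def cr_mult_def cr_one_def cr_omega_def cr_theta_def vec_eq_iff forall_3)

lemma cr_mult_commute: "cr_mult f x y = cr_mult f y x"
  by (cases f) (simp add: cr_mult_def vec_eq_iff forall_3 algebra_simps)

lemma cr_mult_assoc: "cr_mult f (cr_mult f x y) z = cr_mult f x (cr_mult f y z)"
proof (cases f)
  case (BCF a b c d)
  show ?thesis
    unfolding cr_mult_def BCF bcf.case vec_eq_iff forall_3 vector_3
    by (simp add: algebra_simps)
qed

definition cr_trace :: "'a::comm_ring_1 bcf \<Rightarrow> 'a ^ 3 \<Rightarrow> 'a" where
  "cr_trace f x = trace (matrix (cr_mult f x))"

definition cr_traceless :: "real bcf \<Rightarrow> real ^ 3 \<Rightarrow> real ^ 3" where
  "cr_traceless f x = x - (cr_trace f x / 3) *s cr_one"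


section \<open>Reduced forms\<close>

definition real_form :: "int bcf \<Rightarrow> real bcf" where
  "real_form f = map_bcf real_of_int f"

text \<open>Isomorphisms of real algebras \<open>R(f) \<otimes> \<real> \<cong> \<real> \<oplus> \<complex>\<close>.\<close>

definition RC_iso :: "int bcf \<Rightarrow> (real ^ 3 \<Rightarrow> real \<times> complex) \<Rightarrow> bool" where
  "RC_iso f \<phi> \<longleftrightarrow> linear \<phi> \<and> bij \<phi> \<and> \<phi> cr_one = (1, 1) \<and>
     (\<forall>x y. \<phi> (cr_mult (real_form f) x y) =
        (fst (\<phi> x) * fst (\<phi> y), snd (\<phi> x) * snd (\<phi> y)))"

text \<open>The identification \<open>(\<real> \<oplus> \<complex>) / \<real>(1, 1) \<cong> \<complex>\<close> is induced by \<open>(r, w) \<mapsto> w - r\<close>.\<close>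

definition RC_quot :: "real \<times> complex \<Rightarrow> complex" where
  "RC_quot p = snd p - complex_of_real (fst p)"

text \<open>
  There are two isomorphisms, differing by complex conjugation on \<open>\<complex>\<close>; the condition on the
  imaginary part selects one of them.
\<close>

definition tau_neg :: "int bcf \<Rightarrow> complex" where
  "tau_neg f = (THE t. \<exists>\<phi>. RC_iso f \<phi> \<and>
     t = RC_quot (\<phi> cr_theta) / RC_quot (\<phi> cr_omega) \<and> Im t > 0)"

text \<open>
  For \<open>\<xi>\<close> the root of \<open>f(x, 1)\<close> in the upper half plane, \<open>tau_neg f\<close> is \<open>- cnj \<xi>\<close>; in
  particular the defining description is satisfied by exactly one number.
\<close>

lemma tau_neg_eq:
  fixes f and \<xi> :: complex and x0 :: real
  defines "a \<equiv> real_of_int (cf_a f)" and "b \<equiv> real_of_int (cf_b f)"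
    and "c \<equiv> real_of_int (cf_c f)" and "d \<equiv> real_of_int (cf_d f)"
  assumes a0: "a \<noteq> 0" and im: "Im \<xi> > 0"
   and fac: "\<And>x::complex. a * x^3 + b * x^2 + c * x + d = a * (x - x0) * (x - \<xi>) * (x - cnj \<xi>)"
  shows "tau_neg f = - cnj \<xi>"
proof -
  have F: "real_form f = BCF a b c d" by (cases f) (simp add: real_form_def a_def b_def c_def d_def)
  define g where "g x = a * x^3 + b * x^2 + c * x + d" for x :: complex
  have gfac: "g x = a * (x - x0) * (x - \<xi>) * (x - cnj \<xi>)" for x :: complex using fac unfolding g_def .
  have d': "complex_of_real d = - (a * x0 * \<xi> * cnj \<xi>)" using gfac[of 0] by (simp add: g_def)
  have g1: "g 1 + g (-1) = 2 * b + 2 * d" "g 1 - g (-1) = 2 * a + 2 * c" by (simp_all add: g_def)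
  have b': "complex_of_real b = - (a * (x0 + \<xi> + cnj \<xi>))"
  proof -
    have "2 * complex_of_real b = 2 * (- (a * (x0 + \<xi> + cnj \<xi>)))"
      using g1(1) d' unfolding gfac of_real_add of_real_mult of_real_numeral by algebra
    then show ?thesis by simp
  qed
  have c': "complex_of_real c = a * (x0 * \<xi> + x0 * cnj \<xi> + \<xi> * cnj \<xi>)"
  proof -
    have "2 * complex_of_real c = 2 * (a * (x0 * \<xi> + x0 * cnj \<xi> + \<xi> * cnj \<xi>))"
      using g1(2) unfolding gfac of_real_add of_real_mult of_real_numeral by algebra
    then show ?thesis by simp
  qed
  have uniq: "t = - cnj \<xi>" if iso: "RC_iso f \<phi>"
    and t: "t = RC_quot (\<phi> cr_theta) / RC_quot (\<phi> cr_omega)" "Im t > 0" for t \<phi>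
  proof -
    define r s w v where rd: "r = fst (\<phi> cr_omega)" "s = fst (\<phi> cr_theta)"
       "w = snd (\<phi> cr_omega)" "v = snd (\<phi> cr_theta)"
    have lin: "linear \<phi>" and bij: "bij \<phi>" and one: "\<phi> cr_one = (1,1)"
      and mul: "\<And>x y. \<phi> (cr_mult (BCF a b c d) x y) =
        (fst (\<phi> x) * fst (\<phi> y), snd (\<phi> x) * snd (\<phi> y))"
      using iso by (auto simp: RC_iso_def F)
    have om: "cr_mult (BCF a b c d) cr_omega cr_theta = (- (a*d)) *\<^sub>R cr_one"
       "cr_mult (BCF a b c d) cr_omega cr_omega = (- (a*c)) *\<^sub>R cr_one + b *\<^sub>R cr_omega - a *\<^sub>R cr_theta"
      using cr_mult_table(2,3)[of a b c d] by (simp_all add: scalar_mult_eq_scaleR)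
    have L: "fst (\<phi> (k *\<^sub>R x)) = k * fst (\<phi> x)" "snd (\<phi> (k *\<^sub>R x)) = complex_of_real k * snd (\<phi> x)" for k x
      unfolding linear_scale[OF lin] fst_scaleR snd_scaleR by (simp_all add: scaleR_conv_of_real)
    have 1: "r * s = - (a*d)" "w * v = - (complex_of_real a * d)"
      using mul[of cr_omega cr_theta] unfolding om
      by (simp_all only: L one rd prod_eq_iff fst_conv snd_conv) simp_all
    have 2: "r * r = - (a*c) + b * r - a * s"
       "w * w = - (complex_of_real a * c) + b * w - a * v"
      using mul[of cr_omega cr_omega] unfolding om
      by (simp_all only: linear_add[OF lin] linear_diff[OF lin] fst_add snd_add fst_diff snd_diff L one rd prod_eq_iff fst_conv snd_conv) simp_all
    have gr: "g (- complex_of_real r / a) = 0"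
    proof -
      have "r * r * r = - a * c * r + b * r * r + a * a * d" using 1(1) 2(1) by algebra
      moreover define y where "y = - r / a"
      moreover have "r = - (a * y)" using a0 y_def by simp
      ultimately have "a * a * (a * y^3 + b * y^2 + c * y + d) = 0" by algebra
      then have "a * (-r/a)^3 + b * (-r/a)^2 + c * (-r/a) + d = 0"
        using a0 by (simp add: y_def)
      then have "complex_of_real (a * (-r/a)^3 + b * (-r/a)^2 + c * (-r/a) + d) = 0" by simp
      then show ?thesis by (simp add: g_def)
    qed
    have gw: "g (- w / a) = 0"
    proof -
      have "w * w * w = - complex_of_real a * c * w + b * w * w + complex_of_real a * a * d" using 1(2) 2(2) unfolding of_real_mult by algebra
      moreover define y where "y = - w / a"
      moreover have "w = - (a * y)" using a0 y_def by simp
      ultimately have "complex_of_real a * a * (a * y^3 + b * y^2 + c * y + d) = 0" by algebra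
      then show ?thesis unfolding g_def
        using a0 by (simp add: y_def)
    qed
    have wnr: "Im w \<noteq> 0"
    proof
      assume w0: "Im w = 0"
      have "Im (w * w) = Im (- (complex_of_real a * c) + b * w - a * v)" using 2 by simp
      then have v0: "Im v = 0" using w0 a0 by simp
      obtain x where x: "\<phi> x = (0, \<i>)" using bij by (metis bij_pointE)
      have "x = (x$1) *\<^sub>R cr_one + (x$2) *\<^sub>R cr_omega + (x$3) *\<^sub>R cr_theta"
        by (simp add: cr_one_def cr_omega_def cr_theta_def vec_eq_iff forall_3)
      then have "\<phi> x = (x$1) *\<^sub>R \<phi> cr_one + (x$2) *\<^sub>R \<phi> cr_omega + (x$3) *\<^sub>R \<phi> cr_theta"
        by (metis linear_scale[OF lin] linear_add[OF lin])
      then have "Im (snd (\<phi> x)) = 0" using w0 v0 by (simp add: one rd[symmetric])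
      then show False using x by simp
    qed
    have "Im (- complex_of_real r / a) = 0" by simp
    then have "- complex_of_real r / a \<noteq> \<xi>" "- complex_of_real r / a \<noteq> cnj \<xi>"
      using im by (metis less_irrefl, metis complex_cnj_cnj complex_cnj_complex_of_real complex_cnj_divide complex_cnj_minus less_irrefl)
    then have "- complex_of_real r / a = x0" using gr a0 unfolding gfac by simp
    then have r': "complex_of_real r = - a * x0" using a0 by (simp add: field_simps) (metis minus_minus)
    have wn: "- w / a \<noteq> x0"
    proof
      assume "- w / a = x0"
      then have "w = complex_of_real (- a * x0)" using a0 by (simp add: field_simps) (metis minus_minus)
      then show False using wnr by (metis Im_complex_of_real)
    qed
    then have "- w / a = \<xi> \<or> - w / a = cnj \<xi>" using gw a0 unfolding gfac by simp
    then obtain z :: complex where z: "z = \<xi> \<or> z = cnj \<xi>" "w = - a * z"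
    proof -
      have "w = - a * (- w / a)" using a0 by simp
      then show ?thesis using \<open>- w / a = \<xi> \<or> - w / a = cnj \<xi>\<close> that by metis
    qed
    have zn: "z \<noteq> x0" using wn z a0 by auto
    have av: "a * v = - (complex_of_real a * c) + b * w - w * w" using 2(2) by algebra
    have as: "a * complex_of_real s = - (complex_of_real a * c) + b * complex_of_real r - complex_of_real r * r"
    proof -
      have "a * s = - (a * c) + b * r - r * r" using 2 by simp
      then have "complex_of_real (a * s) = complex_of_real (- (a * c) + b * r - r * r)" by simp
      then show ?thesis by simp
    qed
    have wr: "w - complex_of_real r = - a * (z - x0)" using z r' by (simp add: algebra_simps)
    have "a * (v - complex_of_real s) = (w - r) * (b - (w + complex_of_real r))" using av as by algebra
    also have "b - (w + complex_of_real r) = - a * (\<xi> + cnj \<xi> - z)"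
      unfolding b' z r' by (simp add: algebra_simps)
    finally have "complex_of_real a * (v - complex_of_real s) = complex_of_real a * ((w - r) * - (\<xi> + cnj \<xi> - z))" by (simp add: algebra_simps)
    then have "v - complex_of_real s = (w - r) * - (\<xi> + cnj \<xi> - z)" using a0 by simp
    moreover have "w - complex_of_real r \<noteq> 0" unfolding wr using zn a0 by simp
    ultimately have "t = - (\<xi> + cnj \<xi> - z)" unfolding t(1) RC_quot_def rd[symmetric] by simp
    then show ?thesis using z(1) t(2) im by auto
  qed
  define ww where "ww = - complex_of_real a * \<xi>"
  define vv where "vv = - (a * \<xi>^2 + b * \<xi> + c)"
  define rr where "rr = - a * x0"
  define ss where "ss = - (a * x0^2 + b * x0 + c)"
  define \<phi> where "\<phi> x = (x$1 + x$2 * rr + x$3 * ss, complex_of_real (x$1) + x$2 * ww + x$3 * vv)" for x :: "real^3"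
  have lin: "linear \<phi>" 
  proof (rule linearI)
    show "\<phi> (x + y) = \<phi> x + \<phi> y" for x y by (simp add: \<phi>_def algebra_simps)
    show "\<phi> (k *\<^sub>R x) = k *\<^sub>R \<phi> x" for k x
      unfolding \<phi>_def vector_scaleR_component by (simp add: algebra_simps scaleR_conv_of_real)
  qed
  have q1: "vv - complex_of_real ss = (ww - rr) * (- cnj \<xi>)"
    unfolding vv_def ss_def ww_def rr_def by (simp add: b' algebra_simps power2_eq_square)
  have q2: "ww - complex_of_real rr = - a * (\<xi> - x0)" by (simp add: ww_def rr_def algebra_simps)
  have q3: "\<xi> \<noteq> x0" using im by auto
  have inj: "inj \<phi>"
  proof (subst linear_injective_0[OF lin], intro allI impI)
    fix x assume "\<phi> x = 0"
    then have z: "x$1 + x$2 * rr + x$3 * ss = 0" "complex_of_real (x$1) + x$2 * ww + x$3 * vv = 0" 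
      by (simp_all add: \<phi>_def zero_prod_def)
    then have "complex_of_real (x$1 + x$2 * rr + x$3 * ss) = 0" by simp
    moreover have "x$2 * (ww - complex_of_real rr) + x$3 * (vv - complex_of_real ss)
       = (complex_of_real (x$1) + x$2 * ww + x$3 * vv) - complex_of_real (x$1 + x$2 * rr + x$3 * ss)"
      by (simp add: algebra_simps)
    ultimately have "x$2 * (ww - complex_of_real rr) + x$3 * (vv - complex_of_real ss) = 0" using z(2) by simp
    then have "(ww - complex_of_real rr) * (x$2 - x$3 * cnj \<xi>) = 0" unfolding q1 by (simp add: algebra_simps)
    then have k: "x$2 - x$3 * cnj \<xi> = 0" using q2 q3 a0 by simp
    then have "Im (x$2 - x$3 * cnj \<xi>) = 0" by (metis zero_complex.sel(2))
    then have 3: "x$3 = 0" using im by simp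
    then have 2: "x$2 = 0" using k by simp
    show "x = 0" using 2 3 z(1) by (simp add: vec_eq_iff forall_3)
  qed
  have surj: "surj \<phi>"
  proof -
    have "dim (range \<phi>) = dim (UNIV :: (real^3) set)" using dim_image_eq[OF lin, of UNIV] inj by simp
    then have "dim (range \<phi>) = DIM(real \<times> complex)" by simp
    then show ?thesis
      using dim_eq_full subspace_UNIV lin linear_subspace_image span_eq_iff by metis
  qed
  have iso: "RC_iso f \<phi>"
    unfolding RC_iso_def F
  proof (intro conjI allI)
    show "linear \<phi>" by fact
    show "bij \<phi>" using inj surj by (simp add: bij_def)
    show "\<phi> cr_one = (1,1)" by (simp add: \<phi>_def cr_one_def)
    fix x y
    have gx: "g x0 = 0" "g \<xi> = 0" by (simp_all add: gfac)
    have "complex_of_real (a * x0^3 + b * x0^2 + c * x0 + d) = 0" using gx by (simp add: g_def)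
    then have gx0: "a * x0^3 + b * x0^2 + c * x0 + d = 0" using of_real_eq_0_iff by blast
    have R: "rr * ss = - a * d" "rr * rr = - a * c + b * rr - a * ss" "ss * ss = - b * d + d * rr - c * ss"
      unfolding rr_def ss_def using gx0 by (algebra, (simp add: algebra_simps power2_eq_square; fail), algebra)
    have W: "ww * vv = - complex_of_real a * d" "ww * ww = - complex_of_real a * c + b * ww - a * vv" "vv * vv = - complex_of_real b * d + d * ww - c * vv"
      unfolding ww_def vv_def using gx(2)[unfolded g_def] by (algebra, (simp add: algebra_simps power2_eq_square; fail), algebra)
    show "\<phi> (cr_mult (BCF a b c d) x y) = (fst (\<phi> x) * fst (\<phi> y), snd (\<phi> x) * snd (\<phi> y))"
      unfolding \<phi>_def cr_mult_def bcf.case vector_3 prod_eq_iff fst_conv snd_conv of_real_add of_real_diff of_real_mult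
      by (intro conjI, (use R in algebra), (use W in algebra))
  qed
  show ?thesis
    unfolding tau_neg_def
  proof (rule the_equality)
    have "RC_quot (\<phi> cr_theta) / RC_quot (\<phi> cr_omega) = - cnj \<xi>"
      using q1 q2 q3 a0 by (simp add: RC_quot_def \<phi>_def cr_theta_def cr_omega_def)
    then show "\<exists>\<phi>. RC_iso f \<phi> \<and> - cnj \<xi> = RC_quot (\<phi> cr_theta) / RC_quot (\<phi> cr_omega) \<and> 0 < Im (- cnj \<xi>)"
      using iso im by (metis complex_cnj_minus cnj.sel(2) minus_minus uminus_complex.sel(2))
  next
    fix t assume "\<exists>\<phi>. RC_iso f \<phi> \<and> t = RC_quot (\<phi> cr_theta) / RC_quot (\<phi> cr_omega) \<and> 0 < Im t"
    then show "t = - cnj \<xi>" using uniq by blast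
  qed
qed

definition tau_pos :: "int bcf \<Rightarrow> complex" where
  "tau_pos f =
    (let F = real_form f;
         \<omega>0 = cr_traceless F cr_omega;
         \<theta>0 = cr_traceless F cr_theta;
         A0 = cr_trace F (cr_mult F \<omega>0 \<omega>0);
         B0 = cr_trace F (cr_mult F \<omega>0 \<theta>0);
         C0 = cr_trace F (cr_mult F \<theta>0 \<theta>0)
     in (complex_of_real B0 + \<i> * complex_of_real (sqrt (A0 * C0 - B0\<^sup>2))) / complex_of_real A0)"

lemma tau_pos_eq:
  fixes f defines "a \<equiv> real_of_int (cf_a f)" and "b \<equiv> real_of_int (cf_b f)"
    and "c \<equiv> real_of_int (cf_c f)" and "d \<equiv> real_of_int (cf_d f)"
  defines "A \<equiv> 2 / 3 * (b\<^sup>2 - 3 * a * c)" and "B \<equiv> (b * c - 9 * a * d) / 3"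
  shows "tau_pos f = (complex_of_real B + \<i> * sqrt (real_of_int (bcf_disc f) / 3)) / A"
proof -
  obtain x y z w where f: "f = BCF x y z w" by (cases f)
  define C where "C = 2 / 3 * (c\<^sup>2 - 3 * b * d)"
  have tr: "cr_trace (BCF a b c d) v = 3 * v$1 + b * v$2 - c * v$3" for v
    by (simp add: cr_trace_def trace_def matrix_def cr_mult_def sum_3 axis_def algebra_simps)
  have F: "real_form f = BCF a b c d" by (simp add: f real_form_def a_def b_def c_def d_def)
  have o: "cr_traceless (BCF a b c d) cr_omega = vector [- b/3, 1, 0]"
    "cr_traceless (BCF a b c d) cr_theta = vector [c/3, 0, 1]"
    by (simp_all add: cr_traceless_def tr cr_omega_def cr_theta_def cr_one_def vec_eq_iff forall_3)
  have AA: "cr_trace (BCF a b c d) (cr_mult (BCF a b c d) (vector [- b/3, 1, 0]) (vector [- b/3, 1, 0])) = A"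
    "cr_trace (BCF a b c d) (cr_mult (BCF a b c d) (vector [- b/3, 1, 0]) (vector [c/3, 0, 1])) = B"
    "cr_trace (BCF a b c d) (cr_mult (BCF a b c d) (vector [c/3, 0, 1]) (vector [c/3, 0, 1])) = C"
    unfolding tr by (simp_all add: cr_mult_def A_def B_def C_def field_simps power2_eq_square)
  have "A * C - B\<^sup>2 = real_of_int (bcf_disc f) / 3"
    by (simp add: A_def B_def C_def f bcf_disc_def a_def b_def c_def d_def field_simps power2_eq_square power3_eq_cube)
  then show ?thesis
    unfolding tau_pos_def Let_def F o AA by simp
qed

definition tau :: "int bcf \<Rightarrow> complex" where
  "tau f = (if bcf_disc f < 0 then tau_neg f else tau_pos f)"

definition fund_domain :: "complex set" where
  "fund_domain = {z. Im z > 0 \<and> cmod z \<ge> 1 \<and> \<bar>Re z\<bar> \<le> 1 / 2}"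

definition reduced :: "int bcf \<Rightarrow> bool" where
  "reduced f \<longleftrightarrow> tau f \<in> fund_domain"

definition reduced_reps :: "nat \<Rightarrow> int bcf set \<Rightarrow> bool" where
  "reduced_reps i R \<longleftrightarrow>
     (\<forall>f\<in>R. f \<in> irr_forms i \<and> reduced f) \<and>
     (\<forall>f\<in>irr_forms i. \<exists>!h. h \<in> R \<and> h \<in> SL2Z_orbit f)"

definition reps_at :: "int bcf set \<Rightarrow> int ^ 2 \<Rightarrow> int bcf set" where
  "reps_at R P = {f \<in> R. bcf_eval f P = 1}"


section \<open>Normalized Weierstrass models\<close>

text \<open>\<open>WModel u A B\<close> is the equation \<open>y^2 = x^3 + u x^2 + A x + B\<close>.\<close>

datatype wmodel = WModel (wm_u: int) (wm_A: int) (wm_B: int)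

definition normalized :: "wmodel \<Rightarrow> bool" where
  "normalized E \<longleftrightarrow> wm_u E \<in> {0, 1, 2}"

definition model_form :: "wmodel \<Rightarrow> int bcf" where
  "model_form E = BCF 1 (wm_u E) (wm_A E) (wm_B E)"

definition K_irr :: "nat \<Rightarrow> int bcf set" where
  "K_irr i = {BCF 1 u A B | u A B.
     u \<in> {0, 1, 2} \<and> irreducible_over_Q (BCF 1 u A B) \<and> disc_sign i (BCF 1 u A B)}"

definition models_at :: "nat \<Rightarrow> int bcf set \<Rightarrow> int ^ 2 \<Rightarrow> wmodel set" where
  "models_at i R P = {E. normalized E \<and> model_form E \<in> K_irr i \<and>
     (\<exists>U\<in>SL2Z. bcf_act U (model_form E) \<in> R \<and> vector [1, 0] v* matrix_inv U = P)}"


section \<open>The model attached to a form and a vector representing 1\<close>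

definition shear :: "int \<Rightarrow> int ^ 2 ^ 2" where
  "shear k = vector [vector [1, 0], vector [k, 1]]"

lemma shear_mult: "shear k ** shear m = shear (k + m)"
  by (simp add: vec_eq_iff forall_2 matrix_matrix_mult_def sum_2 shear_def)

definition norm_form :: "int ^ 2 ^ 2 \<Rightarrow> int bcf \<Rightarrow> int bcf" where
  "norm_form M f =
    (let b = cf_b (bcf_act M f); u = b mod 3; k = (u - b) div 3
     in bcf_act (shear k ** M) f)"

definition completion :: "int ^ 2 \<Rightarrow> int ^ 2 ^ 2" where
  "completion P = (SOME M. M \<in> SL2Z \<and> row 1 M = P)"

lemma completion_props:
  assumes "coprime (P $ 1) (P $ 2)"
  shows "completion P \<in> SL2Z \<and> row 1 (completion P) = P"
proof -
  obtain x y where "x * P $ 1 + y * P $ 2 = 1"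
    using assms bezout_int[of "P$1" "P$2"] by auto
  then have "vector [vector [P $ 1, P $ 2], vector [- y, x]] \<in> SL2Z \<and>
     row 1 (vector [vector [P $ 1, P $ 2], vector [- y, x]] :: int^2^2) = P"
    by (simp add: SL2Z_def det_2 row_def vec_eq_iff forall_2 algebra_simps)
  then show ?thesis
    unfolding completion_def by (rule someI)
qed

text \<open>Independence of the choice of the matrix.\<close>

lemma norm_form_cong:
  assumes "M \<in> SL2Z" "M' \<in> SL2Z" "row 1 M = row 1 M'"
    and "bcf_eval f (row 1 M) = 1"
  shows "norm_form M f = norm_form M' f"
proof -
  define p q r s r' s' where d: "p = M $ 1 $ 1" "q = M $ 1 $ 2" "r = M $ 2 $ 1" "s = M $ 2 $ 2"
    "r' = M' $ 2 $ 1" "s' = M' $ 2 $ 2"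
  have e: "M' $ 1 $ 1 = p" "M' $ 1 $ 2 = q"
    using assms(3) by (auto simp: d row_def vec_eq_iff)
  have D: "p * s - q * r = 1" "p * s' - q * r' = 1"
    using assms(1,2) e by (auto simp: SL2Z_def det_2 d)
  define m where "m = r' * s - s' * r"
  have m1: "r' = r + m * p"
  proof -
    have "r' * (p * s - q * r) = r + (r' * s - s' * r) * p + r * (p * s' - q * r' - 1)" by algebra
    then show ?thesis using D by (simp add: m_def)
  qed
  have m2: "s' = s + m * q"
  proof -
    have "s' * (p * s - q * r) = s + (r' * s - s' * r) * q + s * (p * s' - q * r' - 1)" by algebra
    then show ?thesis using D by (simp add: m_def)
  qed
  have M': "M' = shear m ** M"
    by (simp add: vec_eq_iff forall_2 matrix_matrix_mult_def sum_2 shear_def e m1 m2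
        flip: d)
  have ds: "det (shear k) = 1" for k by (simp add: det_2 shear_def)
  have dM: "det M = 1" using assms(1) by (simp add: SL2Z_def)
  have "cf_a (bcf_act M f) = 1"
    using assms(4) by (simp add: bcf_act_def Let_def dM bcf_eval_def row_def)
  then have "cf_b (bcf_act M' f) = cf_b (bcf_act M f) + 3 * m"
    unfolding M' bcf_act_mult_int[OF ds dM] by (simp add: bcf_act_def[of "shear m"] ds Let_def) (simp add: shear_def)
  then have b: "cf_b (bcf_act (shear m ** M) f) = cf_b (bcf_act M f) + 3 * m"
    by (simp only: M')
  have "(x mod 3 - x) div 3 = (x mod 3 - (x + 3 * m)) div 3 + m" for x :: int
    by presburger
  then show ?thesis
    unfolding norm_form_def Let_def M' b by (simp add: matrix_mul_assoc shear_mult)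
qed

definition E_model :: "int bcf \<Rightarrow> int ^ 2 \<Rightarrow> wmodel" where
  "E_model f P =
    (let F = norm_form (completion P) f in WModel (cf_b F) (cf_c F) (cf_d F))"

end

theory Submission
  imports Defs
begin

text \<open>
  A matrix \<open>g\<close> in \<open>SL\<^sub>2(\<int>)\<close> with first row \<open>P\<close> takes \<open>f\<close> with \<open>f(P) = 1\<close> to a monic form, and \<open>g\<close>
  is unique up to left shears once \<open>P\<close> is fixed; demanding the \<open>X\<^sup>2 Y\<close>-coefficient to lie in
  \<open>{0, 1, 2}\<close> pins down the shear.  So \<open>E\<^bsub>f,P\<^esub>\<close> remembers the orbit of \<open>f\<close>, hence \<open>f\<close> itself, and the
  inverse of the map sends \<open>E\<close> to \<open>U \<cdot> F\<^sub>E\<close>.  That normalized forms stay irreducible over \<open>\<rat>\<close>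
  follows since \<open>g\<close> acts on \<open>\<rat>[Y][X]\<close> by a ring automorphism.
\<close>

text \<open>A factorization of \<open>\<sigma> p\<close> is pulled back by \<open>\<tau>\<close> to
  one of \<open>p\<close>, and both maps send units to units.\<close>

lemma irreducible_ring_automorphism:
  fixes \<sigma> \<tau> :: "'a::comm_semiring_1 \<Rightarrow> 'a"
  assumes p: "irreducible p"
    and \<sigma>: "\<And>x y. \<sigma> (x * y) = \<sigma> x * \<sigma> y" "\<sigma> 0 = 0" "\<sigma> 1 = 1"
    and \<tau>: "\<And>x y. \<tau> (x * y) = \<tau> x * \<tau> y" "\<tau> 0 = 0" "\<tau> 1 = 1"
    and inv: "\<And>x. \<sigma> (\<tau> x) = x" "\<And>x. \<tau> (\<sigma> x) = x"
  shows "irreducible (\<sigma> p)"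
proof (rule irreducibleI)
  show "\<sigma> p \<noteq> 0"
    using p inv(2)[of p] \<tau>(2) unfolding irreducible_def by metis
  have \<tau>_unit: "\<tau> x dvd 1" if "x dvd 1" for x
    using that by (metis \<tau>(1,3) dvd_def)
  have \<sigma>_unit: "\<sigma> x dvd 1" if "x dvd 1" for x
    using that by (metis \<sigma>(1,3) dvd_def)
  show "\<not> \<sigma> p dvd 1"
    using p \<tau>_unit[of "\<sigma> p"] inv(2) irreducible_not_unit by metis
  fix a b assume "\<sigma> p = a * b"
  then have "p = \<tau> a * \<tau> b" by (metis inv(2) \<tau>(1))
  then have "\<tau> a dvd 1 \<or> \<tau> b dvd 1" using p irreducibleD by blast
  then show "a dvd 1 \<or> b dvd 1" using \<sigma>_unit inv(1) by metis
qed


section \<open>Linear substitutions in bivariate polynomials\<close>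

lemma poly_map_poly_add:
  assumes "h 0 = 0" "\<And>x y. h (x + y) = h x + h y"
  shows "poly (map_poly h (p + q)) x = poly (map_poly h p) x + poly (map_poly h q) x"
proof -
  have "map_poly h (p + q) = map_poly h p + map_poly h q"
    by (rule poly_eqI) (simp add: coeff_map_poly assms)
  then show ?thesis by simp
qed

lemma poly_map_poly_mult:
  fixes h :: "'a::comm_ring_1 \<Rightarrow> 'b::comm_ring_1"
  assumes "h 0 = 0" "\<And>x y. h (x + y) = h x + h y" "\<And>x y. h (x * y) = h x * h y"
  shows "poly (map_poly h (p * q)) x = poly (map_poly h p) x * poly (map_poly h q) x"
proof (induction p)
  case (pCons a p)
  have "map_poly h (smult a q) = smult (h a) (map_poly h q)"
    by (rule poly_eqI) (simp add: coeff_map_poly assms)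
  then show ?case
    using pCons.IH
    by (simp add: poly_map_poly_add map_poly_pCons assms algebra_simps)
qed simp

definition outer_var :: "'a::comm_ring_1 poly poly" where
  "outer_var = [:0, 1:]"

definition inner_var :: "'a::comm_ring_1 poly poly" where
  "inner_var = [:[:0, 1:]:]"

text \<open>The substitution X := L, Y := M is built in two stages: a coefficient, being a
  polynomial in Y, is evaluated at M here, and \<open>subst\<close> then evaluates the outer
  polynomial at L.\<close>

definition subst_inner :: "'a::comm_ring_1 poly poly \<Rightarrow> 'a poly \<Rightarrow> 'a poly poly" where
  "subst_inner M c = poly (map_poly (\<lambda>a. [:[:a:]:]) c) M"

definition subst :: "'a::comm_ring_1 poly poly \<Rightarrow> 'a poly poly \<Rightarrow> 'a poly poly \<Rightarrow> 'a poly poly" where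
  "subst L M p = poly (map_poly (subst_inner M) p) L"

lemma subst_inner_simps:
  "subst_inner M 0 = 0"
  "subst_inner M 1 = 1"
  "subst_inner M (p + q) = subst_inner M p + subst_inner M q"
  "subst_inner M (p * q) = subst_inner M p * subst_inner M q"
  "subst_inner M (pCons a c) = [:[:a:]:] + M * subst_inner M c"
  unfolding subst_inner_def
  by (simp, simp add: map_poly_1 flip: one_pCons, rule poly_map_poly_add, simp, simp,
      rule poly_map_poly_mult, simp_all add: map_poly_pCons)

lemma subst_simps:
  "subst L M 0 = 0"
  "subst L M 1 = 1"
  "subst L M (p + q) = subst L M p + subst L M q"
  "subst L M (p * q) = subst L M p * subst L M q"
  "subst L M (pCons c p) = subst_inner M c + L * subst L M p"
  unfolding subst_def
  by (simp, simp add: map_poly_1 subst_inner_simps, rule poly_map_poly_add,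
      simp_all add: subst_inner_simps poly_map_poly_mult map_poly_pCons)

lemma subst_power: "subst L M (p ^ n) = subst L M p ^ n"
  by (induction n) (simp_all add: subst_simps)

lemma subst_const: "subst L M [:[:a:]:] = [:[:a:]:]"
  by (simp add: subst_simps subst_inner_simps)

lemma subst_of_int: "subst L M (of_int n) = of_int n"
  by (metis of_int_poly subst_const)

lemma smult_const_one: "smult [:1:] (p :: 'a::comm_semiring_1 poly poly) = p"
  by (simp flip: one_pCons)

lemma subst_var: "subst L M outer_var = L" "subst L M inner_var = M"
  by (simp_all add: outer_var_def inner_var_def subst_simps subst_inner_simps smult_const_one)

text \<open>The composite of two substitutions is a ring homomorphism fixing the scalars, so its
  values at the two variables determine it.\<close>

lemma subst_id_if:
  assumes "subst L M (subst L' M' outer_var) = outer_var"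
    and "subst L M (subst L' M' inner_var) = inner_var"
  shows "subst L M (subst L' M' p) = p"
proof (induction p)
  case (pCons c p)
  have inner: "subst L M (subst_inner M' c) = [:c:]"
  proof (induction c)
    case (pCons a c)
    then show ?case
      using assms(2) by (simp add: subst_simps subst_inner_simps subst_var inner_var_def smult_const_one)
  qed (simp add: subst_simps subst_inner_simps)
  then show ?case
    using assms(1) pCons.IH by (simp add: subst_simps subst_inner_simps(1,2) subst_var outer_var_def smult_const_one)
qed (simp add: subst_simps)

definition lin_form :: "int \<Rightarrow> int \<Rightarrow> 'a::comm_ring_1 poly poly" where
  "lin_form x y = of_int x * outer_var + of_int y * inner_var"

text \<open>The columns of \<open>g\<close> give the images of the variables, since the row vector
  (X, Y) is multiplied by \<open>g\<close> on the right.\<close>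

definition subst_mat :: "int ^ 2 ^ 2 \<Rightarrow> 'a::comm_ring_1 poly poly \<Rightarrow> 'a poly poly" where
  "subst_mat g = subst (lin_form (g$1$1) (g$2$1)) (lin_form (g$1$2) (g$2$2))"

lemma subst_lin_form: "subst L M (lin_form x y) = of_int x * L + of_int y * M"
  by (simp add: lin_form_def subst_simps subst_of_int subst_var)

text \<open>Applying \<open>subst_mat g\<close> and then \<open>subst_mat h\<close> sends the
  variables where \<open>h ** g\<close> sends them.\<close>

lemma subst_mat_inverse:
  assumes "h ** g = mat 1"
  shows "subst_mat h (subst_mat g p) = p"
proof -
  have e: "h$i$1 * g$1$j + h$i$2 * g$2$j = (mat 1 :: int^2^2)$i$j" for i j
    unfolding assms[symmetric] by (simp add: matrix_matrix_mult_def sum_2)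
  have c: "of_int u * lin_form (h$1$1) (h$2$1) + of_int v * lin_form (h$1$2) (h$2$2)
      = (lin_form (h$1$1 * u + h$1$2 * v) (h$2$1 * u + h$2$2 * v) :: 'a poly poly)" for u v
    by (simp add: lin_form_def algebra_simps)
  show ?thesis
    unfolding subst_mat_def
    by (rule subst_id_if) (simp_all add: subst_var subst_lin_form c e, simp_all add: mat_def lin_form_def)
qed

text \<open>In this shape the homomorphism rules carry \<open>subst\<close> down to the two
  variables.\<close>

lemma bcf_poly_of_int:
  "bcf_poly (map_bcf rat_of_int f) = of_int (cf_a f) * outer_var ^ 3
     + of_int (cf_b f) * outer_var\<^sup>2 * inner_var + of_int (cf_c f) * outer_var * inner_var\<^sup>2
     + of_int (cf_d f) * inner_var ^ 3"
  by (cases f) (simp add: bcf_poly_def outer_var_def inner_var_def of_int_poly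
      monom_altdef numeral_eq_Suc algebra_simps)

lemma bcf_poly_act:
  assumes "det g = 1"
  shows "bcf_poly (map_bcf rat_of_int (bcf_act g f)) = subst_mat g (bcf_poly (map_bcf rat_of_int f))"
proof -
  obtain a b c d where f: "f = BCF a b c d" by (cases f)
  show ?thesis
    unfolding bcf_poly_of_int subst_mat_def subst_simps subst_power subst_of_int subst_var
      bcf_act_def Let_def assms div_by_1 bcf.sel f lin_form_def of_int_add of_int_mult of_int_power of_int_numeral
    by (simp add: power2_eq_square power3_eq_cube algebra_simps)
qed


section \<open>The action on integral forms\<close>

lemma bcf_act_one: "bcf_act (mat 1 :: int^2^2) f = f"
  by (cases f) (simp add: bcf_act_def mat_def det_2)

text \<open>\<open>matrix_inv\<close> is a choice; as the determinant is 1, the adjugate is an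
  integral two-sided inverse, so there is one to choose.\<close>

lemma matrix_inv_SL2Z:
  assumes "g \<in> SL2Z"
  shows "g ** matrix_inv g = mat 1" "matrix_inv g ** g = mat 1" "matrix_inv g \<in> SL2Z"
proof -
  define h :: "int^2^2" where "h = vector [vector [g$2$2, - g$1$2], vector [- g$2$1, g$1$1]]"
  have "g$1$1 * g$2$2 - g$1$2 * g$2$1 = 1" using assms by (simp add: SL2Z_def det_2)
  then have "g ** h = mat 1 \<and> h ** g = mat 1"
    by (simp add: h_def vec_eq_iff forall_2 matrix_matrix_mult_def sum_2 mat_def algebra_simps)
  then have "g ** matrix_inv g = mat 1 \<and> matrix_inv g ** g = mat 1"
    unfolding matrix_inv_def by (rule someI)
  then show *: "g ** matrix_inv g = mat 1" "matrix_inv g ** g = mat 1" by auto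
  have "det g * det (matrix_inv g) = 1" by (metis *(1) det_mul det_I)
  then show "matrix_inv g \<in> SL2Z" using assms by (simp add: SL2Z_def)
qed

lemma SL2Z_mult: "g \<in> SL2Z \<Longrightarrow> h \<in> SL2Z \<Longrightarrow> g ** h \<in> SL2Z"
  by (simp add: SL2Z_def det_mul)

lemma bcf_act_SL2Z_mult:
  "g \<in> SL2Z \<Longrightarrow> h \<in> SL2Z \<Longrightarrow> bcf_act g (bcf_act h f) = bcf_act (g ** h) f"
  by (simp add: SL2Z_def bcf_act_mult_int)

lemma bcf_act_matrix_inv:
  assumes "g \<in> SL2Z"
  shows "bcf_act (matrix_inv g) (bcf_act g f) = f"
  using assms by (simp add: bcf_act_SL2Z_mult matrix_inv_SL2Z bcf_act_one)

lemma irreducible_over_Q_act: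
  assumes "g \<in> SL2Z" "irreducible_over_Q f"
  shows "irreducible_over_Q (bcf_act g f)"
proof -
  have "irreducible (subst_mat g (bcf_poly (map_bcf rat_of_int f)))"
    using assms(2) unfolding irreducible_over_Q_def
    by (rule irreducible_ring_automorphism[where \<tau> = "subst_mat (matrix_inv g)"])
       (simp_all add: subst_mat_inverse matrix_inv_SL2Z[OF assms(1)], simp_all add: subst_mat_def subst_simps)
  then show ?thesis
    using assms(1) by (simp add: irreducible_over_Q_def bcf_poly_act SL2Z_def)
qed

text \<open>For \<open>hessian f = (A, B, C)\<close>, the determinant of the matrix of second
  derivatives of \<open>f\<close> is -4 (A X^2 + B X Y + C Y^2).\<close>

definition hessian :: "'a::comm_ring_1 bcf \<Rightarrow> 'a \<times> 'a \<times> 'a" where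
  "hessian f = (case f of BCF a b c d \<Rightarrow>
     (b\<^sup>2 - 3 * a * c, b * c - 9 * a * d, c\<^sup>2 - 3 * b * d))"

lemma bcf_disc_hessian:
  assumes "hessian f = (A, B, C)"
  shows "3 * bcf_disc f = 4 * A * C - B\<^sup>2"
proof -
  obtain a b c d where f: "f = BCF a b c d" by (cases f)
  have "A = b\<^sup>2 - 3 * a * c" "B = b * c - 9 * a * d" "C = c\<^sup>2 - 3 * b * d"
    using assms by (simp_all add: f hessian_def)
  then show ?thesis
    by (simp only:) (simp add: f bcf_disc_def power2_eq_square power3_eq_cube algebra_simps)
qed

lemma hessian_act:
  fixes f :: "int bcf"
  assumes D: "det g = 1" and H: "hessian f = (A, B, C)"
    and pqrs: "p = g$1$1" "q = g$1$2" "r = g$2$1" "s = g$2$2"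
  shows "hessian (bcf_act g f) =
    (A * p\<^sup>2 + B * p * q + C * q\<^sup>2,
     2 * A * p * r + B * (p * s + q * r) + 2 * C * q * s,
     A * r\<^sup>2 + B * r * s + C * s\<^sup>2)"
proof -
  obtain a b c d where f: "f = BCF a b c d" by (cases f)
  have ABC: "A = b\<^sup>2 - 3 * a * c" "B = b * c - 9 * a * d" "C = c\<^sup>2 - 3 * b * d"
    using H by (simp_all add: f hessian_def)
  \<comment> \<open>As polynomials in the entries of \<open>g\<close> the two sides differ by the
    factor \<open>(p * s - q * r)\<^sup>2\<close>; inserting it gives a ring identity.\<close>
  have one: "x = y" if "x = (p * s - q * r)\<^sup>2 * y" for x y :: int
    using that D by (simp add: det_2 pqrs)
  show ?thesis
    unfolding hessian_def bcf_act_def Let_def D div_by_1 bcf.case bcf.sel f ABC pqrs[symmetric] prod.inject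
    by (intro conjI; rule one; simp add: power2_eq_square power3_eq_cube algebra_simps)
qed

text \<open>Passing through the Hessian covariant keeps the degrees of the ring identities low.\<close>

lemma bcf_disc_act:
  assumes "g \<in> SL2Z"
  shows "bcf_disc (bcf_act g f) = bcf_disc f"
proof -
  obtain A B C where H: "hessian f = (A, B, C)" by (metis prod_cases3)
  define p q r s where pqrs: "p = g$1$1" "q = g$1$2" "r = g$2$1" "s = g$2$2"
  have D: "det g = 1" "p * s - q * r = 1" using assms by (simp_all add: SL2Z_def det_2 pqrs)
  have "3 * bcf_disc (bcf_act g f) = (p * s - q * r)\<^sup>2 * (4 * A * C - B\<^sup>2)"
    unfolding bcf_disc_hessian[OF hessian_act[OF D(1) H pqrs]]
    by (simp add: power2_eq_square algebra_simps)
  also have "\<dots> = 3 * bcf_disc f"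
    by (simp add: D bcf_disc_hessian[OF H])
  finally show ?thesis by simp
qed

lemma irr_forms_act: "g \<in> SL2Z \<Longrightarrow> f \<in> irr_forms i \<Longrightarrow> bcf_act g f \<in> irr_forms i"
  by (simp add: irr_forms_def disc_sign_def bcf_disc_act irreducible_over_Q_act)


section \<open>Normalization\<close>

lemma shear_SL2Z: "shear k \<in> SL2Z"
  by (simp add: SL2Z_def shear_def det_2)

text \<open>Setting (X, Y) = (1, 0) picks out the leading coefficient and turns (X, Y) g into the
  first row of \<open>g\<close>. Thus f(P) = 1 becomes monicity.\<close>

lemma cf_a_act:
  "g \<in> SL2Z \<Longrightarrow> cf_a (bcf_act g f) = bcf_eval f (row 1 g)"
  by (simp add: SL2Z_def bcf_act_def Let_def bcf_eval_def row_def)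

lemma cf_b_act_shear:
  "cf_b (bcf_act (shear k) f) = cf_b f + 3 * k * cf_a f"
  using shear_SL2Z[of k] by (simp add: SL2Z_def bcf_act_def Let_def) (simp add: shear_def)

lemma row_shear_mult: "row 1 (shear k ** M) = row 1 M"
  by (simp add: row_def shear_def matrix_matrix_mult_def sum_2 vec_eq_iff)

lemma norm_form_props:
  assumes "M \<in> SL2Z" "bcf_eval f (row 1 M) = 1"
  obtains g where "g \<in> SL2Z" "row 1 g = row 1 M" "norm_form M f = bcf_act g f"
    "cf_a (bcf_act g f) = 1" "cf_b (bcf_act g f) \<in> {0, 1, 2}"
proof
  define b where "b = cf_b (bcf_act M f)"
  define k where "k = (b mod 3 - b) div 3"
  define g where "g = shear k ** M"
  show g: "g \<in> SL2Z" unfolding g_def by (intro SL2Z_mult shear_SL2Z assms)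
  show row: "row 1 g = row 1 M" by (simp add: g_def row_shear_mult)
  show "norm_form M f = bcf_act g f"
    by (simp add: norm_form_def Let_def g_def k_def b_def)
  show "cf_a (bcf_act g f) = 1" using cf_a_act[OF g] assms(2) row by simp
  have "cf_b (bcf_act g f) = b + 3 * k"
    using cf_a_act[OF assms(1)] assms
    by (simp add: g_def cf_b_act_shear b_def shear_SL2Z flip: bcf_act_SL2Z_mult)
  \<comment> \<open>The division in \<open>k\<close> is exact, since 3 divides
    \<open>b mod 3 - b\<close>.\<close>
  also have "\<dots> = b mod 3" unfolding k_def by presburger
  finally show "cf_b (bcf_act g f) \<in> {0, 1, 2}"
    by (simp, presburger)
qed

text \<open>A coefficient in {0, 1, 2} is its own residue mod 3, so the shear is trivial.\<close>

lemma norm_form_normalized: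
  assumes "cf_b (bcf_act M f) \<in> {0, 1, 2}"
  shows "norm_form M f = bcf_act M f"
proof -
  have "shear 0 = mat 1" by (simp add: shear_def mat_def vec_eq_iff forall_2)
  then show ?thesis using assms by (auto simp: norm_form_def Let_def)
qed

text \<open>\<open>E_model\<close> drops the leading coefficient and \<open>model_form\<close> puts
  back 1, so a monic form is recovered.\<close>

lemma model_form_E_model:
  assumes "cf_a (norm_form (completion P) f) = 1"
  shows "model_form (E_model f P) = norm_form (completion P) f"
  using assms by (cases "norm_form (completion P) f") (simp add: model_form_def E_model_def Let_def)

lemma model_form_K_irr_iff:
  "model_form E \<in> K_irr i \<longleftrightarrow> normalized E \<and> model_form E \<in> irr_forms i"
  by (cases E) (auto simp: model_form_def K_irr_def normalized_def irr_forms_def)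

lemma unit_vector_matrix_mult: "vector [1, 0] v* g = row 1 (g :: int^2^2)"
  by (simp add: vec_eq_iff vec_matrix_mult_2 row_def)

lemma model_form_E_model_props:
  assumes "coprime (P $ 1) (P $ 2)" "bcf_eval f P = 1"
  obtains g where "g \<in> SL2Z" "row 1 g = P" "model_form (E_model f P) = bcf_act g f"
    "normalized (E_model f P)"
proof -
  note C = completion_props[OF assms(1)]
  obtain g where g: "g \<in> SL2Z" "row 1 g = row 1 (completion P)"
    "norm_form (completion P) f = bcf_act g f"
    "cf_a (bcf_act g f) = 1" "cf_b (bcf_act g f) \<in> {0, 1, 2}"
    using norm_form_props[of "completion P" f] C assms(2) by metis
  have "normalized (E_model f P)"
    using g by (simp add: normalized_def E_model_def Let_def)
  then show ?thesis
    using that g C model_form_E_model by metis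
qed

section \<open>Bijectivity on the chosen reduced representatives\<close>

theorem corollary39:
  fixes i :: nat and R :: "int bcf set" and P :: "int ^ 2"
  assumes "i \<in> {0, 1}"
    and "reduced_reps i R"
    and "coprime (P $ 1) (P $ 2)"
  shows "bij_betw (\<lambda>f. E_model f P) (reps_at R P) (models_at i R P)"
proof (rule bij_betw_imageI)
  have R_irr: "f \<in> irr_forms i" if "f \<in> R" for f
    using assms(2) that by (simp add: reduced_reps_def)
  have R_unique: "f = bcf_act g f" if "f \<in> R" "g \<in> SL2Z" "bcf_act g f \<in> R" for f g
  proof -
    \<comment> \<open>Both forms represent the orbit of \<open>f\<close>, and \<open>R\<close>
      contains only one representative of it.\<close>
    have "f \<in> SL2Z_orbit f" "bcf_act g f \<in> SL2Z_orbit f"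
      using that(2) bcf_act_one[of f, symmetric] by (auto simp: SL2Z_orbit_def SL2Z_def)
    then show ?thesis
      using assms(2) R_irr[OF that(1)] that unfolding reduced_reps_def by blast
  qed
  show "inj_on (\<lambda>f. E_model f P) (reps_at R P)"
  proof (rule inj_onI)
    fix f f' assume f: "f \<in> reps_at R P" and f': "f' \<in> reps_at R P" and eq: "E_model f P = E_model f' P"
    obtain g where g: "g \<in> SL2Z" "model_form (E_model f P) = bcf_act g f"
      using f model_form_E_model_props[OF assms(3), of f] by (auto simp: reps_at_def)
    obtain h where h: "h \<in> SL2Z" "model_form (E_model f' P) = bcf_act h f'"
      using f' model_form_E_model_props[OF assms(3), of f'] by (auto simp: reps_at_def)
    \<comment> \<open>Equal models give g f = h f', so \<open>f\<close> and \<open>f'\<close> share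
      an orbit.\<close>
    have "f' = bcf_act (matrix_inv h ** g) f"
      using g h eq bcf_act_matrix_inv[OF h(1), of f']
      by (simp add: matrix_inv_SL2Z(3) flip: bcf_act_SL2Z_mult)
    then show "f = f'"
      using R_unique[of f "matrix_inv h ** g"] f f' g(1) h(1)
      by (simp add: reps_at_def SL2Z_mult matrix_inv_SL2Z(3))
  qed
  show "(\<lambda>f. E_model f P) ` reps_at R P = models_at i R P"
  proof (intro equalityI subsetI)
    fix E assume "E \<in> (\<lambda>f. E_model f P) ` reps_at R P"
    then obtain f where f: "f \<in> R" "bcf_eval f P = 1" and E: "E = E_model f P"
      by (auto simp: reps_at_def)
    obtain g where g: "g \<in> SL2Z" "row 1 g = P" "model_form E = bcf_act g f" "normalized E"
      using model_form_E_model_props[OF assms(3) f(2)] unfolding E by metis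
    \<comment> \<open>This \<open>U\<close> carries the model's form back to \<open>f\<close>, and
      its inverse \<open>g\<close> has first row \<open>P\<close>.\<close>
    define U where "U = matrix_inv g"
    have U: "U \<in> SL2Z" "bcf_act U (model_form E) = f"
      unfolding U_def g(3) by (simp_all add: g(1) matrix_inv_SL2Z bcf_act_matrix_inv)
    have "matrix_inv U = g ** U ** matrix_inv U"
      by (simp add: U_def matrix_inv_SL2Z[OF g(1)])
    also have "\<dots> = g"
      by (simp add: matrix_inv_SL2Z[OF U(1)] flip: matrix_mul_assoc)
    finally show "E \<in> models_at i R P"
      using f U g irr_forms_act[OF g(1) R_irr[OF f(1)]]
      by (auto simp: models_at_def model_form_K_irr_iff unit_vector_matrix_mult intro!: bexI[of _ U])
  next
    fix E assume "E \<in> models_at i R P"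
    then obtain U where E: "normalized E" and U: "U \<in> SL2Z" "bcf_act U (model_form E) \<in> R"
      and row: "row 1 (matrix_inv U) = P"
      by (auto simp: models_at_def unit_vector_matrix_mult)
    define f where "f = bcf_act U (model_form E)"
    define V where "V = matrix_inv U"
    note C = completion_props[OF assms(3)]
    have V: "V \<in> SL2Z" "bcf_act V f = model_form E"
      unfolding V_def f_def by (simp_all add: U(1) matrix_inv_SL2Z bcf_act_matrix_inv)
    \<comment> \<open>\<open>V\<close> has first row \<open>P\<close>, so f(P) is the leading
      coefficient of the model's form.\<close>
    have fP: "bcf_eval f P = 1"
      using cf_a_act[OF V(1), of f] row V by (simp add: V_def model_form_def)
    \<comment> \<open>Both matrices complete \<open>P\<close>, so the arbitrary completion may be
      exchanged for \<open>V\<close>, which already yields a normalized form.\<close>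
    have "norm_form (completion P) f = norm_form V f"
      using C V row fP by (intro norm_form_cong) (simp_all add: V_def)
    also have "\<dots> = model_form E"
      using E V by (subst norm_form_normalized) (simp_all add: normalized_def model_form_def)
    finally have "E = E_model f P"
      by (cases E) (simp add: model_form_def E_model_def Let_def)
    then show "E \<in> (\<lambda>f. E_model f P) ` reps_at R P"
      using U fP by (auto simp: reps_at_def f_def)
  qed
qed

end
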